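(* Let a triangle in spherical geometry have side lengths $a,b,c$, circumradius $R$, and inradius $r$. Then $$\frac{\tan R}{\tan r}\ \ge\ \frac{\sin\frac a2\sin\frac b2\sin\frac c2+\sin^3\frac a2+\sin^3\frac b2+\sin^3\frac c2}{2\sin\frac a2\sin\frac b2\sin\frac c2}$$ $$\ge\ \frac12\left(\frac{\sin\frac a2}{\sin\frac b2}+\frac{\sin\frac b2}{\sin\frac a2}+\frac{\sin\frac a2}{\sin\frac c2}+\frac{\sin\frac c2}{\sin\frac a2}+\frac{\sin\frac b2}{\sin\frac c2}+\frac{\sin\frac c2}{\sin\frac b2}\right)-1$$ $$\ge\ \frac13\left(\frac{\sin\frac a2}{\sin\frac b2}+\frac{\sin\frac b2}{\sin\frac a2}+\frac{\sin\frac a2}{\sin\frac c2}+\frac{\sin\frac c2}{\sin\frac a2}+\frac{\sin\frac b2}{\sin\frac c2}+\frac{\sin\frac c2}{\sin\frac b2}\right)\ \ge\ 2.$$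
   Context: Spherical triangles are nondegenerate and lie on the unit sphere $S^2$ (curvature $1$): the three vertices do not lie on a common great circle and the sides are the minor great-circle arcs joining them, so each side has length in $(0,\pi)$. $R$ and $r$ are the spherical radii, in $(0,\pi/2)$, of the circumscribed and inscribed circles; they satisfy $$\tan R=\frac{2\sin\frac a2\sin\frac b2\sin\frac c2}{\sqrt{\sin\frac{a+b+c}2\sin\frac{a+b-c}2\sin\frac{a+c-b}2\sin\frac{b+c-a}2}},\qquad \tan r=\sqrt{\frac{\sin\frac{a+b-c}2\sin\frac{a+c-b}2\sin\frac{b+c-a}2}{\sin\frac{a+b+c}2}}.$$ *)

theory Defs
  imports "HOL-Analysis.Analysis"
begin

text \<open>The unit sphere is \<^term>\<open>sphere (0::real^3) 1\<close>. The radian measure of the angle between two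
  unit vectors is the length of the shortest great-circle arc joining them.\<close>

definition sph_dist :: "real^3 \<Rightarrow> real^3 \<Rightarrow> real" where
  "sph_dist x y = arccos (x \<bullet> y)"

definition great_circle :: "real^3 \<Rightarrow> (real^3) set" where
  "great_circle n = {x \<in> sphere 0 1. n \<bullet> x = 0}"

definition sph_circle :: "real^3 \<Rightarrow> real \<Rightarrow> (real^3) set" where
  "sph_circle p \<rho> = {x \<in> sphere 0 1. sph_dist p x = \<rho>}"

text \<open>Spherical convex hull, by central projection of the convex cone spanned by a set. For two
  points of the sphere that are neither equal nor antipodal it is the minor great-circle arc
  joining them; for the vertices of a nondegenerate triangle it is the closed triangular region.\<close>

definition sph_hull :: "(real^3) set \<Rightarrow> (real^3) set" where
  "sph_hull S = sphere 0 1 \<inter> convex_cone hull S"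

definition spherical_triangle :: "real^3 \<Rightarrow> real^3 \<Rightarrow> real^3 \<Rightarrow> bool" where
  "spherical_triangle A B C \<longleftrightarrow>
     {A, B, C} \<subseteq> sphere 0 1 \<and> \<not> (\<exists>n. n \<noteq> 0 \<and> {A, B, C} \<subseteq> great_circle n)"

text \<open>The bound \<^term>\<open>R < pi / 2\<close> selects one of the two antipodal centres of the circle through
  the vertices.\<close>

definition is_circumradius :: "real^3 \<Rightarrow> real^3 \<Rightarrow> real^3 \<Rightarrow> real \<Rightarrow> bool" where
  "is_circumradius A B C R \<longleftrightarrow>
     0 < R \<and> R < pi / 2 \<and> (\<exists>p \<in> sphere 0 1. {A, B, C} \<subseteq> sph_circle p R)"

text \<open>The inscribed circle lies in the closed triangular region and is tangent to each side, that
  is, it meets each of the three minor arcs in exactly one point.\<close>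

definition is_inradius :: "real^3 \<Rightarrow> real^3 \<Rightarrow> real^3 \<Rightarrow> real \<Rightarrow> bool" where
  "is_inradius A B C r \<longleftrightarrow>
     0 < r \<and> r < pi / 2 \<and>
     (\<exists>p \<in> sphere 0 1. sph_circle p r \<subseteq> sph_hull {A, B, C} \<and>
        (\<exists>!x. x \<in> sph_circle p r \<inter> sph_hull {B, C}) \<and>
        (\<exists>!x. x \<in> sph_circle p r \<inter> sph_hull {C, A}) \<and>
        (\<exists>!x. x \<in> sph_circle p r \<inter> sph_hull {A, B}))"

end

theory Submission
  imports Defs
begin

text \<open>
  Write \<open>x, y, z\<close> for the sines of half the sides and \<open>D\<close> for the determinant \<open>A \<bullet> (B \<times> C)\<close>.
  Expanding the circumcentre in the normals of the side planes gives \<open>tan R = 4 x y z / |D|\<close>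
  (lemma \<open>tan_circumradius\<close>); expanding the incentre in the vertices gives
  \<open>tan r = |D| / (2 sin ((a + b + c) / 2))\<close> (lemma \<open>tan_inradius\<close>). For the latter, the circle lies
  on one side of each side plane and touches it, which fixes the distance of the centre from that
  plane. The Gram determinant \<open>D\<^sup>2\<close> factors as \<open>4 sin ((a + b + c) / 2) P\<close>, where \<open>P\<close> is the product of
  the sines of \<open>(a + b - c) / 2\<close>, \<open>(a + c - b) / 2\<close> and \<open>(b + c - a) / 2\<close>, so that
  \<open>tan R / tan r = 2 x y z / P\<close>. That \<open>D\<^sup>2\<close> is positive also yields the triangle inequalities and
  \<open>a + b + c < 2 \<pi>\<close>, hence \<open>P > 0\<close>.

  The spherical product \<open>P\<close> is at most its Euclidean counterpart
  \<open>(x + y - z) (x + z - y) (y + z - x)\<close> (lemma \<open>half_perimeter_sine_product_le\<close>), which turns the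
  first inequality into one between polynomials in \<open>x, y, z\<close>, valid for all positive numbers (lemma
  \<open>strengthened_euler_polynomial\<close>). The second inequality is Schur's inequality divided by
  \<open>2 x y z\<close>. The last two both say that the sum of the six ratios is at least \<open>6\<close>, which holds
  because \<open>t + 1 / t \<ge> 2\<close> for \<open>t > 0\<close>.
\<close>

unbundle cross3_syntax

section \<open>Two symmetric polynomial inequalities\<close>

text \<open>Schur's inequality of degree one, in expanded form. For ordered arguments it is visibly a sum
  of nonnegative products.\<close>

lemma schur_ineq:
  fixes x y z :: real
  assumes "0 \<le> x" "0 \<le> y" "0 \<le> z"
  shows "x^2 * y + x^2 * z + y^2 * x + y^2 * z + z^2 * x + z^2 * y
    \<le> x^3 + y^3 + z^3 + 3 * x * y * z"
proof -
  have ordered: "u^2 * v + u^2 * w + v^2 * u + v^2 * w + w^2 * u + w^2 * v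
      \<le> u^3 + v^3 + w^3 + 3 * u * v * w"
    if "v \<le> u" "w \<le> v" "0 \<le> w" for u v w :: real
  proof -
    have "0 \<le> (u - v)^2 * (u + v - w) + w * ((u - w) * (v - w))"
      using that by (intro add_nonneg_nonneg mult_nonneg_nonneg) auto
    then show ?thesis
      by (simp add: power2_eq_square power3_eq_cube algebra_simps)
  qed
  consider "y \<le> x \<and> z \<le> y" | "z \<le> x \<and> y \<le> z" | "x \<le> y \<and> z \<le> x"
    | "z \<le> y \<and> x \<le> z" | "x \<le> z \<and> y \<le> x" | "y \<le> z \<and> x \<le> y"
    by linarith
  then show ?thesis
    using ordered[of y x z] ordered[of z x y] ordered[of x y z]
      ordered[of z y x] ordered[of x z y] ordered[of y z x] assms
    by cases (simp_all add: algebra_simps)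
qed

text \<open>For a Euclidean triangle with sides \<open>x, y, z\<close> this is the strengthened Euler inequality
  \<open>R / r \<ge> (x y z + x\<^sup>3 + y\<^sup>3 + z\<^sup>3) / (2 x y z)\<close>, because there
  \<open>R / r = 2 x y z / ((x + y - z) (x + z - y) (y + z - x))\<close>. The difference of the two sides is
  \<open>S\<^sub>x (y - z)\<^sup>2 + S\<^sub>y (x - z)\<^sup>2 + S\<^sub>z (x - y)\<^sup>2\<close>, where
  \<open>S\<^sub>x = T (y + z - x) / 2 - x\<^sup>2 y z\<close> with \<open>T = x\<^sup>3 + y\<^sup>3 + z\<^sup>3\<close>, and similarly for the others.
  If \<open>x \<ge> y \<ge> z\<close>, only \<open>S\<^sub>x\<close> can be negative; but then \<open>(x - z)\<^sup>2 \<ge> (y - z)\<^sup>2\<close> and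
  \<open>S\<^sub>x + S\<^sub>y \<ge> 0\<close>.\<close>

lemma strengthened_euler_polynomial:
  fixes x y z :: real
  assumes "0 < x" "0 < y" "0 < z"
  shows "(x * y * z + x^3 + y^3 + z^3) * ((x + y - z) * (x + z - y) * (y + z - x))
    \<le> 4 * (x * y * z)^2"
proof -
  have ordered: "(u * v * w + u^3 + v^3 + w^3) * ((u + v - w) * (u + w - v) * (v + w - u))
      \<le> 4 * (u * v * w)^2"
    if uv: "v \<le> u" and vw: "w \<le> v" and w: "0 < w" for u v w :: real
  proof -
    define T M where "T = u^3 + v^3 + w^3" and "M = u * v * w"
    define Su Sv Sw where "Su = T * (v + w - u) / 2 - M * u"
      and "Sv = T * (u + w - v) / 2 - M * v" and "Sw = T * (u + v - w) / 2 - M * w"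
    have pos: "0 < u" "0 < v" using that by auto
    have T: "u * v * (u + v) \<le> T"
    proof -
      have "0 \<le> (u + v) * (u - v)^2 + w^3" using pos w by simp
      then show ?thesis by (simp add: T_def power2_eq_square power3_eq_cube algebra_simps)
    qed
    have T0: "0 \<le> T" using pos w by (simp add: T_def)
    have uvle: "0 \<le> u * v * w * (u - v)" using pos w uv by simp
    have Sv: "0 \<le> Sv"
    proof -
      have "u * v * (u + v) * w \<le> T * (u + w - v)"
        using T T0 uv pos w by (intro mult_mono) auto
      then show ?thesis using uvle by (simp add: Sv_def M_def algebra_simps)
    qed
    have Sw: "0 \<le> Sw"
    proof -
      have "u * v * (u + v) * v \<le> T * (u + v - w)"
        using T T0 uv vw pos w by (intro mult_mono) auto
      moreover have "u * v * (w * w) \<le> u * v * (v * v)"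
        using pos w vw by (intro mult_left_mono mult_mono) auto
      moreover have "u * v * (v * v) \<le> u * v * (u * v)"
        using pos uv by (intro mult_left_mono mult_right_mono) auto
      ultimately show ?thesis by (simp add: Sw_def M_def algebra_simps)
    qed
    have SuSv: "0 \<le> Su + Sv"
    proof -
      have "Su + Sv = w * (w^3 + (u + v) * (u - v)^2)"
        unfolding Su_def Sv_def T_def M_def by (simp add: field_simps power2_eq_square power3_eq_cube)
      also have "\<dots> \<ge> 0" using pos w by simp
      finally show ?thesis .
    qed
    have "(v - w)^2 \<le> (u - w)^2" using uv vw by (intro power_mono) auto
    then have "0 \<le> (Su + Sv) * (v - w)^2 + Sv * ((u - w)^2 - (v - w)^2) + Sw * (u - v)^2"
      using Sv Sw SuSv by simp
    also have "\<dots> = 4 * (u * v * w)^2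
        - (u * v * w + u^3 + v^3 + w^3) * ((u + v - w) * (u + w - v) * (v + w - u))"
      unfolding Su_def Sv_def Sw_def T_def M_def
      by (simp add: field_simps power2_eq_square power3_eq_cube)
    finally show ?thesis by simp
  qed
  consider "y \<le> x \<and> z \<le> y" | "z \<le> x \<and> y \<le> z" | "x \<le> y \<and> z \<le> x"
    | "z \<le> y \<and> x \<le> z" | "x \<le> z \<and> y \<le> x" | "y \<le> z \<and> x \<le> y"
    by linarith
  then show ?thesis
    using ordered[of y x z] ordered[of z x y] ordered[of x y z]
      ordered[of z y x] ordered[of x z y] ordered[of y z x] assms
    by cases (simp_all add: ac_simps)
qed

section \<open>Spherical triangles and the triangle of half-angle sines\<close>

lemma gram_trig:
  fixes a b c :: real
  shows "1 + 2 * cos a * cos b * cos c - (cos a)^2 - (cos b)^2 - (cos c)^2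
    = (cos c - cos (a + b)) * (cos (a - b) - cos c)"
proof -
  have "(cos c - cos (a + b)) * (cos (a - b) - cos c)
    = 2 * cos a * cos b * cos c - (cos c)^2 - (cos a)^2 * (cos b)^2 + (sin a)^2 * (sin b)^2"
    by (simp add: cos_add cos_diff power2_eq_square algebra_simps)
  then show ?thesis
    by (simp add: sin_squared_eq algebra_simps)
qed

lemma gram_half_angle_sines:
  fixes a b c :: real
  shows "1 + 2 * cos a * cos b * cos c - (cos a)^2 - (cos b)^2 - (cos c)^2
    = 4 * sin ((a + b + c) / 2)
        * (sin ((a + b - c) / 2) * sin ((a + c - b) / 2) * sin ((b + c - a) / 2))"
proof -
  have "cos c - cos (a + b) = 2 * sin ((a + b + c) / 2) * sin ((a + b - c) / 2)"
    using cos_diff_cos[of c "a + b"] by (simp add: ac_simps)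
  moreover have "cos (a - b) - cos c = 2 * sin ((a + c - b) / 2) * sin ((b + c - a) / 2)"
    using cos_diff_cos[of "a - b" c] by (simp add: algebra_simps)
  ultimately show ?thesis by (simp add: gram_trig)
qed

text \<open>The Gram determinant of three unit vectors at mutual angles \<open>a, b, c\<close> factors as
  \<open>(cos c - cos (a + b)) (cos (a - b) - cos c)\<close>. As the two factors have a nonnegative sum,
  positivity makes both positive, and cosine is decreasing on \<open>[0, \<pi>]\<close>.\<close>

lemma spherical_side_bounds:
  fixes a b c :: real
  assumes a: "0 < a" "a < pi" and b: "0 < b" "b < pi" and c: "0 < c" "c < pi"
    and gram: "0 < 1 + 2 * cos a * cos b * cos c - (cos a)^2 - (cos b)^2 - (cos c)^2"
  shows "c < a + b" and "a < b + c" and "b < a + c" and "a + b + c < 2 * pi"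
proof -
  have "cos (a - b) - cos (a + b) = 2 * (sin a * sin b)"
    by (simp add: cos_add cos_diff)
  then have "cos (a + b) \<le> cos (a - b)"
    using sin_gt_zero[OF a] sin_gt_zero[OF b] by (smt (verit) mult_pos_pos)
  moreover have "0 < (cos c - cos (a + b)) * (cos (a - b) - cos c)"
    using gram by (simp add: gram_trig)
  ultimately have cos_bounds: "cos (a + b) < cos c" "cos c < cos (a - b)"
    by (auto simp: zero_less_mult_iff)
  have "cos c < cos \<bar>a - b\<bar>" using cos_bounds by simp
  then have "\<bar>a - b\<bar> < c"
    using a b c by (smt (verit) cos_monotone_0_pi_le)
  then show "a < b + c" "b < a + c" by auto
  show "c < a + b"
  proof (cases "a + b \<le> pi")
    case True
    then show ?thesis
      using cos_bounds(1) a b c by (smt (verit) cos_monotone_0_pi_le)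
  next
    case False
    then show ?thesis using c by simp
  qed
  show "a + b + c < 2 * pi"
  proof (cases "a + b \<le> pi")
    case True
    then show ?thesis using c by simp
  next
    case False
    have "cos (2 * pi - (a + b)) < cos c" using cos_bounds(1) by (simp add: cos_diff)
    then show ?thesis
      using False a b c by (smt (verit) cos_monotone_0_pi_le)
  qed
qed

text \<open>Both differences are multiples of \<open>2 sin ((b - c) / 4)\<close>, with the factors
  \<open>cos ((b + c) / 4)\<close> and \<open>cos ((b - c) / 4)\<close>.\<close>

lemma half_sine_difference_le:
  fixes b c :: real
  assumes "0 \<le> b" "b \<le> pi" "0 \<le> c" "c \<le> pi"
  shows "(sin (b / 2) - sin (c / 2))^2 \<le> (sin ((b - c) / 2))^2"
proof -
  have diff: "sin (b / 2) - sin (c / 2) = 2 * sin ((b - c) / 4) * cos ((b + c) / 4)"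
    using sin_diff_sin[of "b / 2" "c / 2"] by (simp add: diff_divide_distrib add_divide_distrib)
  have double: "sin ((b - c) / 2) = 2 * sin ((b - c) / 4) * cos ((b - c) / 4)"
    using sin_double[of "(b - c) / 4"] by (simp add: diff_divide_distrib)
  have "0 \<le> cos ((b + c) / 4)" using assms by (intro cos_ge_zero) auto
  moreover have "cos ((b + c) / 4) \<le> cos \<bar>(b - c) / 4\<bar>"
    using assms by (intro cos_monotone_0_pi_le) auto
  ultimately have "(cos ((b + c) / 4))^2 \<le> (cos ((b - c) / 4))^2"
    by (intro power_mono) (simp_all only: cos_abs_real)
  then show ?thesis
    unfolding diff double power_mult_distrib by (intro mult_left_mono) auto
qed

lemma half_sine_product_le:
  fixes a b c :: real
  assumes "0 \<le> b" "b \<le> pi" "0 \<le> c" "c \<le> pi"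
  shows "sin ((a + b - c) / 2) * sin ((a + c - b) / 2)
    \<le> (sin (a / 2))^2 - (sin (b / 2) - sin (c / 2))^2"
proof -
  define u v where "u = a / 2" and "v = (b - c) / 2"
  have "sin ((a + b - c) / 2) * sin ((a + c - b) / 2) = sin (u + v) * sin (u - v)"
    by (simp add: u_def v_def field_simps)
  also have "\<dots> = (sin u)^2 * (cos v)^2 - (cos u)^2 * (sin v)^2"
    by (simp add: sin_add sin_diff power2_eq_square algebra_simps)
  also have "\<dots> = (sin u)^2 - (sin v)^2"
    by (simp add: cos_squared_eq algebra_simps)
  finally show ?thesis
    using half_sine_difference_le[OF assms] by (simp add: u_def v_def)
qed

text \<open>Pairing the factors of the left-hand side two at a time bounds its square by the square of the
  right-hand side. This is how the spherical problem reduces to the Euclidean one: the right-hand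
  side belongs to the Euclidean triangle with sides \<open>sin (a / 2), sin (b / 2), sin (c / 2)\<close>, which is
  half the size of the chord triangle.\<close>

lemma half_perimeter_sine_product_le:
  fixes a b c :: real
  defines "x \<equiv> sin (a / 2)" and "y \<equiv> sin (b / 2)" and "z \<equiv> sin (c / 2)"
  assumes a: "0 < a" "a < pi" and b: "0 < b" "b < pi" and c: "0 < c" "c < pi"
    and tri: "c < a + b" "a < b + c" "b < a + c" and per: "a + b + c < 2 * pi"
  shows "sin ((a + b - c) / 2) * sin ((a + c - b) / 2) * sin ((b + c - a) / 2)
    \<le> (x + y - z) * (x + z - y) * (y + z - x)"
proof -
  define p q s where "p = sin ((a + b - c) / 2)" and "q = sin ((a + c - b) / 2)"
    and "s = sin ((b + c - a) / 2)"
  have pos: "0 < p" "0 < q" "0 < s"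
    unfolding p_def q_def s_def using a b c tri per by (auto intro!: sin_gt_zero)
  have xyz: "0 < x" "0 < y" "0 < z"
    unfolding x_def y_def z_def using a b c by (auto intro!: sin_gt_zero)
  have pq: "p * q \<le> x^2 - (y - z)^2"
    unfolding p_def q_def x_def y_def z_def using b c by (intro half_sine_product_le) auto
  have ps: "p * s \<le> y^2 - (x - z)^2"
    using half_sine_product_le[of a c b] a c
    by (simp add: p_def s_def x_def y_def z_def ac_simps)
  have qs: "q * s \<le> z^2 - (x - y)^2"
    using half_sine_product_le[of a b c] a b
    by (simp add: q_def s_def x_def y_def z_def ac_simps)
  have "0 < p * q" "0 < p * s" "0 < q * s" using pos by simp_all
  then have "(y - z)^2 < x^2" "(x - z)^2 < y^2" "(x - y)^2 < z^2"
    using pq ps qs by linarith+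
  then have "\<bar>y - z\<bar> < x" "\<bar>x - z\<bar> < y" "\<bar>x - y\<bar> < z"
    using xyz power2_less_imp_less[of "\<bar>y - z\<bar>" x] power2_less_imp_less[of "\<bar>x - z\<bar>" y]
      power2_less_imp_less[of "\<bar>x - y\<bar>" z] by simp_all
  then have euclid: "0 < x + y - z" "0 < x + z - y" "0 < y + z - x" by auto
  have "(p * q) * (p * s) * (q * s)
      \<le> (x^2 - (y - z)^2) * (y^2 - (x - z)^2) * (z^2 - (x - y)^2)"
    using pos pq ps qs \<open>(y - z)^2 < x^2\<close> \<open>(x - z)^2 < y^2\<close>
    by (intro mult_mono mult_nonneg_nonneg) auto
  then have "(p * q * s)^2 \<le> ((x + y - z) * (x + z - y) * (y + z - x))^2"
    by (simp add: power2_eq_square algebra_simps)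
  then show ?thesis
    unfolding p_def[symmetric] q_def[symmetric] s_def[symmetric]
    using euclid by (auto intro: power2_le_imp_le)
qed

section \<open>Determinants and cross products of three unit vectors\<close>

lemma inner_cross_cross:
  fixes a b c d :: "real^3"
  shows "(a \<times> b) \<bullet> (c \<times> d) = (a \<bullet> c) * (b \<bullet> d) - (a \<bullet> d) * (b \<bullet> c)"
  by (simp add: cross3_simps)

lemma triple_product_rotate:
  fixes A B C :: "real^3"
  shows "B \<bullet> (C \<times> A) = A \<bullet> (B \<times> C)"
  by (simp add: cross3_simps)

text \<open>Cramer's rule.\<close>

lemma expand_in_vertices:
  fixes A B C p :: "real^3"
  shows "(A \<bullet> (B \<times> C)) *\<^sub>R p
    = (p \<bullet> (B \<times> C)) *\<^sub>R A + (p \<bullet> (C \<times> A)) *\<^sub>R B + (p \<bullet> (A \<times> B)) *\<^sub>R C"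
  by (simp add: cross3_simps forall_3)

text \<open>Expansion in the basis dual, up to scaling, to \<open>A, B, C\<close>.\<close>

lemma expand_in_side_normals:
  fixes A B C p :: "real^3"
  shows "(A \<bullet> (B \<times> C)) *\<^sub>R p
    = (p \<bullet> A) *\<^sub>R (B \<times> C) + (p \<bullet> B) *\<^sub>R (C \<times> A) + (p \<bullet> C) *\<^sub>R (A \<times> B)"
  by (simp add: cross3_simps forall_3)

lemma triple_product_squared:
  fixes A B C :: "real^3"
  assumes "A \<bullet> A = 1" "B \<bullet> B = 1" "C \<bullet> C = 1"
  shows "(A \<bullet> (B \<times> C))^2
    = 1 + 2 * (B \<bullet> C) * (C \<bullet> A) * (A \<bullet> B) - (B \<bullet> C)^2 - (C \<bullet> A)^2 - (A \<bullet> B)^2"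
proof -
  have "(A \<bullet> (B \<times> C))^2 = ((A \<bullet> (B \<times> C)) *\<^sub>R A) \<bullet> (B \<times> C)"
    by (simp add: power2_eq_square)
  also have "\<dots> = 1 + 2 * (B \<bullet> C) * (C \<bullet> A) * (A \<bullet> B)
      - (B \<bullet> C)^2 - (C \<bullet> A)^2 - (A \<bullet> B)^2"
    using assms unfolding expand_in_side_normals[of A B C A]
    by (simp add: inner_add_left inner_cross_cross inner_commute power2_eq_square algebra_simps)
  finally show ?thesis .
qed

lemma triple_product_nonzero:
  assumes "spherical_triangle A B C"
  shows "A \<bullet> (B \<times> C) \<noteq> 0"
proof
  assume "A \<bullet> (B \<times> C) = 0"
  then have "det (vector [A, B, C] :: real^3^3) = 0" by (simp add: dot_cross_det)
  then have "rank (vector [A, B, C] :: real^3^3) \<noteq> CARD(3)"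
    using det_eq_0_rank by (metis less_irrefl)
  then obtain n :: "real^3" where n: "n \<noteq> 0" "(vector [A, B, C] :: real^3^3) *v n = 0"
    using matrix_nonfull_linear_equations_eq by blast
  have "A \<bullet> n = 0" "B \<bullet> n = 0" "C \<bullet> n = 0"
    using n(2) by (simp_all add: vec_eq_iff forall_3 matrix_vector_mul_component)
  then have "{A, B, C} \<subseteq> great_circle n"
    using assms by (auto simp: spherical_triangle_def great_circle_def inner_commute)
  with assms n(1) show False by (auto simp: spherical_triangle_def)
qed

lemma inner_eq_1_of_sphere: "x \<in> sphere 0 1 \<Longrightarrow> x \<bullet> x = 1"
  by (simp add: norm_eq_1)

lemma abs_inner_le_1:
  fixes x y :: "real^3"
  assumes "x \<bullet> x = 1" "y \<bullet> y = 1"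
  shows "\<bar>x \<bullet> y\<bar> \<le> 1"
  using Cauchy_Schwarz_ineq2[of x y] assms by (simp add: norm_eq_sqrt_inner)

lemma cos_sph_dist:
  assumes "x \<bullet> x = 1" "y \<bullet> y = 1"
  shows "cos (sph_dist x y) = x \<bullet> y"
  using abs_inner_le_1[OF assms] by (simp add: sph_dist_def cos_arccos_abs)

lemma sin_sph_dist:
  assumes "x \<bullet> x = 1" "y \<bullet> y = 1"
  shows "sin (sph_dist x y) = norm (x \<times> y)"
proof -
  have "norm (x \<times> y) = sqrt (1 - (x \<bullet> y)^2)"
    using assms by (simp add: norm_eq_sqrt_inner inner_cross_cross inner_commute power2_eq_square)
  then show ?thesis
    using abs_inner_le_1[OF assms] by (simp add: sph_dist_def sin_arccos_abs)
qed

lemma sph_dist_strict_bounds: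
  assumes "x \<bullet> x = 1" "y \<bullet> y = 1" "x \<times> y \<noteq> 0"
  shows "0 < sph_dist x y" "sph_dist x y < pi"
proof -
  have "0 \<le> sph_dist x y" "sph_dist x y \<le> pi"
    using abs_inner_le_1[OF assms(1,2)]
    by (auto simp: sph_dist_def intro!: arccos_lbound arccos_ubound)
  moreover have "sin (sph_dist x y) \<noteq> 0" using sin_sph_dist[OF assms(1,2)] assms(3) by simp
  ultimately show "0 < sph_dist x y" "sph_dist x y < pi"
    by (metis sin_zero less_eq_real_def, metis sin_pi less_eq_real_def)
qed

lemma sph_circle_iff:
  assumes "p \<bullet> p = 1" "0 \<le> \<rho>" "\<rho> \<le> pi"
  shows "x \<in> sph_circle p \<rho> \<longleftrightarrow> x \<bullet> x = 1 \<and> p \<bullet> x = cos \<rho>"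
proof -
  have "sph_dist p x = \<rho> \<longleftrightarrow> p \<bullet> x = cos \<rho>" if "x \<bullet> x = 1"
    using cos_sph_dist[OF assms(1) that] assms(2,3) by (auto simp: sph_dist_def arccos_cos)
  then show ?thesis by (auto simp: sph_circle_def norm_eq_1)
qed

section \<open>The circumradius\<close>

text \<open>All three vertices have inner product \<open>cos R\<close> with the centre, so \<open>D p\<close> is \<open>cos R\<close> times the
  sum of the side normals, where \<open>D\<close> is the determinant and \<open>p\<close> the centre. The squared length of
  that sum exceeds \<open>D\<^sup>2\<close> by the last factor on the right, which is \<open>16\<close> times the product of the
  squares of the sines of half the sides.\<close>

lemma circumradius_relation:
  fixes A B C p :: "real^3"
  assumes unit: "A \<bullet> A = 1" "B \<bullet> B = 1" "C \<bullet> C = 1" "p \<bullet> p = 1"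
    and centre: "p \<bullet> A = cos R" "p \<bullet> B = cos R" "p \<bullet> C = cos R"
  shows "((A \<bullet> (B \<times> C)) * sin R)^2
    = (cos R)^2 * (2 * (1 - B \<bullet> C) * (1 - C \<bullet> A) * (1 - A \<bullet> B))"
proof -
  define D where "D = A \<bullet> (B \<times> C)"
  have Dp: "D *\<^sub>R p = cos R *\<^sub>R (B \<times> C + C \<times> A + A \<times> B)"
    unfolding D_def expand_in_side_normals[of A B C p] centre by (simp add: scaleR_add_right)
  have D2: "D^2 = 1 + 2 * (B \<bullet> C) * (C \<bullet> A) * (A \<bullet> B)
      - (B \<bullet> C)^2 - (C \<bullet> A)^2 - (A \<bullet> B)^2"
    unfolding D_def by (rule triple_product_squared[OF unit(1-3)])
  have "(B \<times> C + C \<times> A + A \<times> B) \<bullet> (B \<times> C + C \<times> A + A \<times> B)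
      = D^2 + 2 * (1 - B \<bullet> C) * (1 - C \<bullet> A) * (1 - A \<bullet> B)"
    unfolding D2 using unit(1-3)
    by (simp add: inner_add_left inner_add_right inner_cross_cross inner_commute
        power2_eq_square algebra_simps)
  moreover have "D^2 = (D *\<^sub>R p) \<bullet> (D *\<^sub>R p)" using unit(4) by (simp add: power2_eq_square)
  ultimately have "D^2 = (cos R)^2 * (D^2 + 2 * (1 - B \<bullet> C) * (1 - C \<bullet> A) * (1 - A \<bullet> B))"
    unfolding Dp by (simp add: power2_eq_square)
  then show ?thesis
    unfolding D_def[symmetric] by (simp add: power_mult_distrib sin_squared_eq algebra_simps)
qed

lemma one_minus_cos_half:
  fixes t :: real
  shows "1 - cos t = 2 * (sin (t / 2))^2"
  using cos_double_sin[of "t / 2"] by simp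

lemma tan_circumradius:
  assumes unit: "A \<bullet> A = 1" "B \<bullet> B = 1" "C \<bullet> C = 1"
    and D: "A \<bullet> (B \<times> C) \<noteq> 0"
    and R: "is_circumradius A B C R"
    and x: "0 \<le> sin (sph_dist B C / 2)" and y: "0 \<le> sin (sph_dist C A / 2)"
    and z: "0 \<le> sin (sph_dist A B / 2)"
  shows "tan R = 4 * sin (sph_dist B C / 2) * sin (sph_dist C A / 2) * sin (sph_dist A B / 2)
    / \<bar>A \<bullet> (B \<times> C)\<bar>"
proof -
  define X where "X = sin (sph_dist B C / 2) * sin (sph_dist C A / 2) * sin (sph_dist A B / 2)"
  from R obtain p where R0: "0 < R" "R < pi / 2" and p: "p \<bullet> p = 1"
    and circ: "{A, B, C} \<subseteq> sph_circle p R"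
    by (auto simp: is_circumradius_def norm_eq_1)
  have cosR: "0 < cos R" using R0 by (intro cos_gt_zero) auto
  have sinR: "0 < sin R" using R0 by (intro sin_gt_zero) auto
  have centre: "p \<bullet> A = cos R" "p \<bullet> B = cos R" "p \<bullet> C = cos R"
    using circ R0 by (auto simp: sph_circle_iff[OF p])
  have half: "1 - B \<bullet> C = 2 * (sin (sph_dist B C / 2))^2"
    "1 - C \<bullet> A = 2 * (sin (sph_dist C A / 2))^2"
    "1 - A \<bullet> B = 2 * (sin (sph_dist A B / 2))^2"
    using one_minus_cos_half cos_sph_dist unit by metis+
  have "((A \<bullet> (B \<times> C)) * sin R)^2 = (cos R * (4 * X))^2"
    unfolding circumradius_relation[OF unit p centre] half X_def by (simp add: power2_eq_square)
  then have "\<bar>(A \<bullet> (B \<times> C)) * sin R\<bar> = \<bar>cos R * (4 * X)\<bar>"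
    by (simp add: power2_eq_iff abs_eq_iff)
  moreover have "0 \<le> X" using x y z by (simp add: X_def)
  ultimately have "\<bar>A \<bullet> (B \<times> C)\<bar> * sin R = cos R * (4 * X)"
    using cosR sinR by (simp add: abs_mult)
  then show ?thesis
    using D cosR by (simp add: tan_def X_def field_simps)
qed

section \<open>The inradius\<close>

text \<open>On a circle about \<open>p\<close> of radius \<open>r\<close> the functional \<open>N \<bullet> _\<close> takes its minimum
  \<open>cos r (N \<bullet> p) - sin r |M|\<close> opposite to the component \<open>M\<close> of \<open>N\<close> orthogonal to \<open>p\<close>. The
  hypotheses say that this minimum is \<open>0\<close>, and \<open>|M|\<^sup>2 = |N|\<^sup>2 - (N \<bullet> p)\<^sup>2\<close>.\<close>

lemma circle_tangent_to_plane:
  fixes N p x :: "real^3"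
  assumes p: "p \<bullet> p = 1" and r: "0 < r" "r < pi / 2"
    and side: "\<And>y. y \<in> sph_circle p r \<Longrightarrow> 0 \<le> N \<bullet> y"
    and touch: "x \<in> sph_circle p r" "N \<bullet> x = 0"
  shows "N \<bullet> p = sin r * norm N"
proof -
  have cosr: "0 < cos r" using r by (intro cos_gt_zero) auto
  have sinr: "0 < sin r" using r by (intro sin_gt_zero) auto
  have circle: "y \<in> sph_circle p r \<longleftrightarrow> y \<bullet> y = 1 \<and> p \<bullet> y = cos r" for y
    using r by (intro sph_circle_iff p) auto
  define h M where "h = N \<bullet> p" and "M = N - h *\<^sub>R p"
  have pM: "p \<bullet> M = 0" using p by (simp add: M_def h_def inner_diff_right inner_commute)
  have NM: "N \<bullet> M = M \<bullet> M" and N2: "N \<bullet> N = h^2 + M \<bullet> M"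
    using p by (simp_all add: M_def h_def inner_diff_left inner_diff_right inner_commute
        power2_eq_square algebra_simps)
  have M2: "M \<bullet> M = (norm M)^2" by (simp add: power2_norm_eq_inner)
  have eq: "cos r * h = sin r * norm M"
  proof (rule antisym)
    define e where "e = x - cos r *\<^sub>R p"
    have x: "x \<bullet> x = 1" "p \<bullet> x = cos r" using touch circle by auto
    have "e \<bullet> e = 1 - (cos r)^2"
      using x p by (simp add: e_def inner_diff_left inner_diff_right inner_commute
          power2_eq_square)
    then have "e \<bullet> e = (sin r)^2" by (simp add: sin_squared_eq)
    then have norm_e: "norm e = sin r" using sinr by (simp add: norm_eq_sqrt_inner)
    have "M \<bullet> e = N \<bullet> e"
      using x p by (simp add: M_def e_def inner_diff_left inner_diff_right algebra_simps)
    then have "cos r * h = - (M \<bullet> e)"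
      using touch(2) by (simp add: e_def h_def inner_diff_right)
    also have "\<dots> \<le> norm M * norm e" using Cauchy_Schwarz_ineq2[of M e] by linarith
    finally show "cos r * h \<le> sin r * norm M" by (simp add: norm_e mult.commute)
  next
    show "sin r * norm M \<le> cos r * h"
    proof (cases "M = 0")
      case True
      then have "N = h *\<^sub>R p" by (simp add: M_def)
      with touch circle cosr have "h = 0" by auto
      with True show ?thesis by simp
    next
      case False
      define y where "y = cos r *\<^sub>R p - (sin r / norm M) *\<^sub>R M"
      have "y \<bullet> y = (cos r)^2 + (sin r)^2"
        using p pM False M2
        by (simp add: y_def inner_diff_left inner_diff_right inner_commute power2_eq_square)
      moreover have "p \<bullet> y = cos r" using p pM by (simp add: y_def inner_diff_right)
      ultimately have "0 \<le> N \<bullet> y" by (intro side) (simp add: circle)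
      moreover have "N \<bullet> y = cos r * h - sin r * norm M"
        using False NM M2 by (simp add: y_def h_def inner_diff_right power2_eq_square)
      ultimately show ?thesis by simp
    qed
  qed
  have "(cos r)^2 * h^2 = (sin r)^2 * (N \<bullet> N - h^2)"
    using arg_cong[OF eq, of "\<lambda>t. t^2"] N2 M2 by (simp add: power_mult_distrib)
  then have "h^2 = (sin r)^2 * (N \<bullet> N)"
    by (simp add: cos_squared_eq algebra_simps)
  then have "h^2 = (sin r * norm N)^2"
    by (simp add: power_mult_distrib power2_norm_eq_inner)
  moreover have "0 \<le> h"
  proof -
    have "0 \<le> cos r * h" unfolding eq using sinr by simp
    with cosr show ?thesis by (simp add: zero_le_mult_iff)
  qed
  ultimately show ?thesis
    unfolding h_def[symmetric] using sinr by (simp add: power2_eq_imp_eq)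
qed

text \<open>Orienting the normal \<open>B \<times> C\<close> by the sign of the determinant puts \<open>A\<close>, hence the whole
  triangle, on the nonnegative side of the plane of \<open>B\<close> and \<open>C\<close>.\<close>

lemma incentre_side_distance:
  fixes A B C p :: "real^3"
  assumes D: "A \<bullet> (B \<times> C) \<noteq> 0"
    and p: "p \<bullet> p = 1" and r: "0 < r" "r < pi / 2"
    and inside: "sph_circle p r \<subseteq> sph_hull {A, B, C}"
    and touch: "x \<in> sph_circle p r \<inter> sph_hull {B, C}"
  shows "sgn (A \<bullet> (B \<times> C)) * (p \<bullet> (B \<times> C)) = sin r * norm (B \<times> C)"
proof -
  define N where "N = sgn (A \<bullet> (B \<times> C)) *\<^sub>R (B \<times> C)"
  have BC: "N \<bullet> B = 0" "N \<bullet> C = 0" by (simp_all add: N_def dot_cross_self)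
  have A: "0 \<le> N \<bullet> A"
    by (simp add: N_def inner_commute[of "B \<times> C" A] sgn_if)
  have side: "convex_cone hull S \<subseteq> {y. 0 \<le> n \<bullet> y}" if "\<And>y. y \<in> S \<Longrightarrow> 0 \<le> n \<bullet> y"
    for S and n :: "real^3"
    using that by (intro hull_minimal convex_cone_halfspace_ge) auto
  have "convex_cone hull {B, C} \<subseteq> {y. 0 \<le> N \<bullet> y}"
    "convex_cone hull {B, C} \<subseteq> {y. 0 \<le> (- N) \<bullet> y}"
    using BC by (intro side; auto)+
  then have "0 \<le> N \<bullet> x" "0 \<le> (- N) \<bullet> x"
    using touch by (auto simp: sph_hull_def)
  then have on_plane: "N \<bullet> x = 0" by simp
  have "convex_cone hull {A, B, C} \<subseteq> {y. 0 \<le> N \<bullet> y}"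
    using A BC by (intro side) auto
  then have "0 \<le> N \<bullet> y" if "y \<in> sph_circle p r" for y
    using that inside by (auto simp: sph_hull_def)
  then have "N \<bullet> p = sin r * norm N"
    using touch on_plane by (intro circle_tangent_to_plane[OF p r]) auto
  then show ?thesis
    using D by (simp add: N_def inner_commute norm_sgn)
qed

text \<open>The centre has the same signed distance \<open>sin r\<close> from the planes of the three sides, so \<open>D p\<close>,
  with \<open>D\<close> the determinant and \<open>p\<close> the centre, is \<open>\<plusminus> sin r\<close> times
  \<open>sin a A + sin b B + sin c C\<close>. The squared length of this vector exceeds \<open>D\<^sup>2\<close> by
  \<open>2 - 2 cos (a + b + c)\<close>.\<close>

lemma tan_inradius:
  assumes unit: "A \<bullet> A = 1" "B \<bullet> B = 1" "C \<bullet> C = 1"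
    and D: "A \<bullet> (B \<times> C) \<noteq> 0"
    and r: "is_inradius A B C r"
    and s: "0 < sin ((sph_dist B C + sph_dist C A + sph_dist A B) / 2)"
  shows "tan r = \<bar>A \<bullet> (B \<times> C)\<bar> / (2 * sin ((sph_dist B C + sph_dist C A + sph_dist A B) / 2))"
proof -
  define d where "d = A \<bullet> (B \<times> C)"
  define a b c where "a = sph_dist B C" and "b = sph_dist C A" and "c = sph_dist A B"
  from r obtain p where r0: "0 < r" "r < pi / 2" and p: "p \<bullet> p = 1"
    and inside: "sph_circle p r \<subseteq> sph_hull {A, B, C}"
    and touch: "\<exists>x. x \<in> sph_circle p r \<inter> sph_hull {B, C}"
      "\<exists>x. x \<in> sph_circle p r \<inter> sph_hull {C, A}"
      "\<exists>x. x \<in> sph_circle p r \<inter> sph_hull {A, B}"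
    unfolding is_inradius_def by (metis inner_eq_1_of_sphere)
  have cosr: "0 < cos r" using r0 by (intro cos_gt_zero) auto
  have sinr: "0 < sin r" using r0 by (intro sin_gt_zero) auto
  have cosines: "B \<bullet> C = cos a" "C \<bullet> A = cos b" "A \<bullet> B = cos c"
    using unit by (simp_all add: cos_sph_dist a_def b_def c_def)
  have rot: "B \<bullet> (C \<times> A) = d" "C \<bullet> (A \<times> B) = d"
    by (simp_all add: d_def triple_product_rotate)
  have sets: "{A, B, C} = {B, C, A}" "{A, B, C} = {C, A, B}" by auto
  have dist: "sgn d * (p \<bullet> (B \<times> C)) = sin r * sin a"
    "sgn d * (p \<bullet> (C \<times> A)) = sin r * sin b"
    "sgn d * (p \<bullet> (A \<times> B)) = sin r * sin c"
    using touch incentre_side_distance[OF _ p r0, of A B C] incentre_side_distance[OF _ p r0, of B C A]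
      incentre_side_distance[OF _ p r0, of C A B] inside sets rot unit D
    by (auto simp: sin_sph_dist a_def b_def c_def d_def)
  define V where "V = sin a *\<^sub>R A + sin b *\<^sub>R B + sin c *\<^sub>R C"
  have "sgn d *\<^sub>R (d *\<^sub>R p) = sin r *\<^sub>R V"
    unfolding d_def expand_in_vertices[of A B C p] unfolding d_def[symmetric]
    by (simp add: scaleR_add_right dist V_def)
  then have "\<bar>d\<bar> *\<^sub>R p = sin r *\<^sub>R V" by (simp add: abs_sgn mult.commute)
  then have "(\<bar>d\<bar> *\<^sub>R p) \<bullet> (\<bar>d\<bar> *\<^sub>R p) = (sin r *\<^sub>R V) \<bullet> (sin r *\<^sub>R V)" by simp
  then have dV: "d^2 = (sin r)^2 * (V \<bullet> V)"
    using p by (simp add: power2_eq_square)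
  have "V \<bullet> V = (sin a)^2 + (sin b)^2 + (sin c)^2 + 2 * sin a * sin b * cos c
      + 2 * sin b * sin c * cos a + 2 * sin c * sin a * cos b"
    using unit cosines
    by (simp add: V_def inner_add_left inner_add_right inner_commute power2_eq_square algebra_simps)
  moreover have "d^2 = 1 + 2 * cos a * cos b * cos c - (cos a)^2 - (cos b)^2 - (cos c)^2"
    using triple_product_squared[OF unit] by (simp add: d_def cosines)
  ultimately have "V \<bullet> V - d^2 = 2 * (1 - cos (a + b + c))"
    by (simp add: sin_squared_eq cos_add sin_add algebra_simps)
  also have "\<dots> = (2 * sin ((a + b + c) / 2))^2"
    by (simp add: one_minus_cos_half power2_eq_square)
  finally have "(sin r * (2 * sin ((a + b + c) / 2)))^2 = (sin r)^2 * (V \<bullet> V - d^2)"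
    by (simp add: power_mult_distrib)
  also have "\<dots> = d^2 * (1 - (sin r)^2)" using dV by (simp add: algebra_simps)
  also have "\<dots> = (\<bar>d\<bar> * cos r)^2" by (simp add: power_mult_distrib cos_squared_eq)
  finally have "(sin r * (2 * sin ((a + b + c) / 2)))^2 = (\<bar>d\<bar> * cos r)^2" .
  moreover have s': "0 < sin ((a + b + c) / 2)" using s by (simp add: a_def b_def c_def)
  ultimately have "sin r * (2 * sin ((a + b + c) / 2)) = \<bar>d\<bar> * cos r"
    using sinr cosr power2_eq_imp_eq[of "sin r * (2 * sin ((a + b + c) / 2))" "\<bar>d\<bar> * cos r"]
    by simp
  then have "tan r = \<bar>d\<bar> / (2 * sin ((a + b + c) / 2))"
    using s' cosr by (simp add: tan_def divide_eq_eq eq_divide_eq ac_simps)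
  then show ?thesis by (simp add: d_def a_def b_def c_def)
qed

section \<open>The chain of inequalities\<close>

lemma sum_of_ratios_ge_6:
  fixes x y z :: real
  assumes "0 < x" "0 < y" "0 < z"
  shows "6 \<le> x / y + y / x + x / z + z / x + y / z + z / y"
proof -
  have two: "2 \<le> u / v + v / u" if "0 < u" "0 < v" for u v :: real
  proof -
    have "u / v + v / u = 2 + (u - v)^2 / (u * v)"
      using that by (simp add: field_simps power2_eq_square)
    then show ?thesis using that by simp
  qed
  show ?thesis using two[of x y] two[of x z] two[of y z] assms by linarith
qed

lemma cubes_ratio_ge_sum_of_ratios:
  fixes x y z :: real
  assumes "0 < x" "0 < y" "0 < z"
  shows "1 / 2 * (x / y + y / x + x / z + z / x + y / z + z / y) - 1
    \<le> (x * y * z + x^3 + y^3 + z^3) / (2 * x * y * z)"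
proof -
  have "1 / 2 * (x / y + y / x + x / z + z / x + y / z + z / y) - 1
      = (x^2 * y + x^2 * z + y^2 * x + y^2 * z + z^2 * x + z^2 * y - 2 * x * y * z)
        / (2 * x * y * z)"
    using assms by (simp add: field_simps power2_eq_square)
  also have "\<dots> \<le> (x * y * z + x^3 + y^3 + z^3) / (2 * x * y * z)"
    using schur_ineq[of x y z] assms by (intro divide_right_mono) auto
  finally show ?thesis .
qed

theorem theorem4p2:
  fixes A B C :: "real^3" and a b c R r :: real
  assumes "spherical_triangle A B C"
    and "a = sph_dist B C" and "b = sph_dist C A" and "c = sph_dist A B"
    and "is_circumradius A B C R" and "is_inradius A B C r"
  shows "let x = sin (a / 2); y = sin (b / 2); z = sin (c / 2);
             S = x / y + y / x + x / z + z / x + y / z + z / y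
         in tan R / tan r \<ge> (x * y * z + x ^ 3 + y ^ 3 + z ^ 3) / (2 * x * y * z) \<and>
            (x * y * z + x ^ 3 + y ^ 3 + z ^ 3) / (2 * x * y * z) \<ge> 1 / 2 * S - 1 \<and>
            1 / 2 * S - 1 \<ge> 1 / 3 * S \<and>
            1 / 3 * S \<ge> 2"
proof -
  define x y z where "x = sin (a / 2)" and "y = sin (b / 2)" and "z = sin (c / 2)"
  define d where "d = A \<bullet> (B \<times> C)"
  define s P where "s = sin ((a + b + c) / 2)"
    and "P = sin ((a + b - c) / 2) * sin ((a + c - b) / 2) * sin ((b + c - a) / 2)"
  have unit: "A \<bullet> A = 1" "B \<bullet> B = 1" "C \<bullet> C = 1"
    using assms(1) by (simp_all add: spherical_triangle_def norm_eq_1)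
  have d: "d \<noteq> 0" unfolding d_def by (rule triple_product_nonzero[OF assms(1)])
  have normals: "B \<times> C \<noteq> 0" "C \<times> A \<noteq> 0" "A \<times> B \<noteq> 0"
    using d triple_product_rotate[of B C A] triple_product_rotate[of C A B]
    by (auto simp: d_def)
  have a: "0 < a" "a < pi" and b: "0 < b" "b < pi" and c: "0 < c" "c < pi"
    using sph_dist_strict_bounds unit normals by (auto simp: assms(2-4))
  have d2: "d^2 = 1 + 2 * cos a * cos b * cos c - (cos a)^2 - (cos b)^2 - (cos c)^2"
    using triple_product_squared[OF unit] unit by (simp add: d_def assms(2-4) cos_sph_dist)
  then have gram: "0 < 1 + 2 * cos a * cos b * cos c - (cos a)^2 - (cos b)^2 - (cos c)^2"
    using d by (metis zero_less_power2)
  note tri = spherical_side_bounds[OF a b c gram]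
  have xyz: "0 < x" "0 < y" "0 < z"
    unfolding x_def y_def z_def using a b c by (auto intro!: sin_gt_zero)
  have s: "0 < s" unfolding s_def using a b c tri by (intro sin_gt_zero) auto
  have P: "0 < P"
    unfolding P_def using a b c tri by (intro mult_pos_pos sin_gt_zero) auto
  have "tan R = 4 * x * y * z / \<bar>d\<bar>"
    using tan_circumradius[OF unit _ assms(5)] d xyz
    by (simp add: d_def x_def y_def z_def assms(2-4))
  moreover have "tan r = \<bar>d\<bar> / (2 * s)"
    using tan_inradius[OF unit _ assms(6)] d s by (simp add: d_def s_def assms(2-4))
  ultimately have "tan R / tan r = 8 * x * y * z * s / \<bar>d\<bar>^2"
    using d s by (simp add: power2_eq_square)
  also have "\<bar>d\<bar>^2 = 4 * s * P" unfolding power2_abs d2 gram_half_angle_sines s_def P_def ..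
  also have "8 * x * y * z * s / (4 * s * P) = 2 * x * y * z / P"
    using s by simp
  finally have ratio: "tan R / tan r = 2 * x * y * z / P" .
  have "(x * y * z + x^3 + y^3 + z^3) * P
      \<le> (x * y * z + x^3 + y^3 + z^3) * ((x + y - z) * (x + z - y) * (y + z - x))"
    unfolding P_def x_def y_def z_def
    using half_perimeter_sine_product_le[OF a b c tri] xyz
    by (intro mult_left_mono) (auto simp: x_def y_def z_def)
  also have "\<dots> \<le> 4 * (x * y * z)^2" by (rule strengthened_euler_polynomial[OF xyz])
  finally have first: "(x * y * z + x^3 + y^3 + z^3) / (2 * x * y * z) \<le> tan R / tan r"
    unfolding ratio using xyz P by (simp add: field_simps power2_eq_square)
  define S where "S = x / y + y / x + x / z + z / x + y / z + z / y"
  have "6 \<le> S" unfolding S_def by (rule sum_of_ratios_ge_6[OF xyz])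
  then have "1 / 3 * S \<le> 1 / 2 * S - 1" "2 \<le> 1 / 3 * S" by linarith+
  then show ?thesis
    using first cubes_ratio_ge_sum_of_ratios[OF xyz]
    unfolding S_def Let_def x_def[symmetric] y_def[symmetric] z_def[symmetric] by blast
qed

end
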